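(* Let $n\ge2$, $K>0$. There is a constant $c_*=c_*(n,K)>0$ such that the following holds. Let $Q$, $\{H_\Omega\}_{\Omega\in Q}$, $U\in Q$ and $V\subset C(\overline U)$ be as described in the context and satisfy properties (P1)–(P8) listed there, with constants $C_1,C_2,C_3$ and exponents $\zeta>1$, $\alpha>0$. Assume that $U$ is a $1$-sided NTA domain with constant $K$ and that $0\in\partial U$. Let $u_1,u_2\in V$ satisfy $u_i>0$ on $U\cap B_1$ and $u_i=0$ on $\partial U\cap B_1$ ($i=1,2$), and assume that for some $\beta\in(0,\zeta)$ and $C_4>0$ $$u_i(x)\ge C_4\, d(x,\partial U\cap B_1)^\beta\qquad\text{for all }x\in U,\ i=1,2.$$ In addition, assume that $u_1(x^0)=1$ for some $x^0\in U\cap B_{c_*}(0)$ with $d(x^0,\partial U)\ge c_*^2$. Then $$\frac{u_1}{u_2}\le C_*\quad\text{on } B_{c_*}\cap U,$$ where the constant $C_*$ depends only on $n,K,C_1,C_2,C_3,C_4,\zeta,\beta,\alpha$.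
   Context: $B_r(x)$ is the open ball in $\mathbb{R}^n$, $B_r=B_r(0)$, and $d(x,E)$ is the distance from $x$ to $E$. Setting. $Q$ is a collection of open subsets of $\mathbb{R}^n$, and for each $\Omega\in Q$, $H_\Omega: C(\Omega)\times C(\partial\Omega)\to C(\overline\Omega)$ is a map (to be thought of as a solution operator: first argument the right-hand side, second argument the boundary data). When a function $g$ is defined on a larger set, $H_\Omega[f,g]$ means that $f$ and $g$ are restricted to $\Omega$ and $\partial\Omega$ respectively. $U\in Q$ is fixed, and $V\subset C(\overline U)$ is some subset of the set of functions $u\ge0$ for which $H_U[f,u]=u$ on $U$ for some $f$. Properties: (P1) Localization: for every $r>0$ and $x\in\overline U$ there is a set $U_{x,r}\in Q$ such that $U_{x,r}\subset B_{2r}(x)$ and $U\cap B_r(x)=U_{x,r}\cap B_r(x)$. (P2) Homogeneity: $H_\Omega[0,0]=0$ for every $\Omega\in Q$. (P3) Solvability: if $\Omega\in Q$, then $H_\Omega[f,g]=g$ on $\partial\Omega$ for any $g\in C(\partial\Omega)$. (P4) Extension: if $\Omega\subset\Omega'$ are in $Q$, then $H_\Omega[f|_\Omega, H_{\Omega'}[f,g]|_{\partial\Omega}]=H_{\Omega'}[f,g]$ on $\Omega$. (P5) Comparison: if $f_1\ge f_2$ and $g_1\le g_2$, then $H_\Omega[f_1,g_1]\le H_\Omega[f_2,g_2]$. (P6) Approximation: there are $C_1$ and $\zeta>1$ such that for any set $\Omega=U_{x,r}$ from (P1) with $r\le\frac14$, $x\in B_{1/2}\cap\partial U_{x,r}$,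 and any $u\in V$, $|u-H_\Omega[0,u]|\le C_1r^\zeta$ on $\Omega$. (P7) Harnack: for any $u\in V$ and $B_{2r}(x)\subset U$, $\sup_{B_r(x)}u\le C_2[\inf_{B_r(x)}u+1]$. (P8) Boundary Harnack: for any $a\in\partial U$ and $\Omega=U_{a,r}$ from (P1), if $u_1,u_2$ satisfy $H_\Omega[0,u_1]=u_1$, $H_\Omega[0,u_2]=u_2$, $u_1,u_2\ge0$ on $\Omega$, and $u_1=u_2=0$ on $\partial U\cap B_r(a)$, then $$\frac{u_1(x)}{u_2(x)}\le\Big(1+C_3\frac{|x-y|^\alpha}{r^\alpha}\Big)\frac{u_1(y)}{u_2(y)}\quad\text{for any }x,y\in U\cap B_{r/2}(a).$$ A domain $\Omega\subset\mathbb{R}^n$ is a $1$-sided NTA domain with constant $K$ if: (D1) for every $x\in\partial\Omega$ and $0<r<\operatorname{diam}(\Omega)$ there is a ball $B_{r/K}(y)\subset\Omega\cap B_r(x)$; and (D2) for every $x,y\in\Omega$ there is a curve $\gamma:[0,1]\to\Omega$ with $\gamma(0)=x$, $\gamma(1)=y$, $l(\gamma([0,1]))\le K|x-y|$, and $\min\{l(\gamma([0,t])),l(\gamma([t,1]))\}\le K\,d(\gamma(t),\partial\Omega)$ for all $t\in[0,1]$, where $l$ denotes length. *)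

theory Defs
  imports "HOL-Analysis.Analysis"
begin

text \<open>Length of the restriction of a curve to a parameter interval: the supremum of the lengths
  of inscribed polygons, possibly infinite. For \<^term>\<open>a \<le> b\<close> only the sortedness of the list of
  parameters matters; repeated parameters contribute nothing.\<close>

definition curve_length :: "(real \<Rightarrow> 'a::metric_space) \<Rightarrow> real \<Rightarrow> real \<Rightarrow> ennreal" where
  "curve_length \<gamma> a b =
     (SUP ts\<in>{ts. sorted ts \<and> set ts \<subseteq> {a..b}}.
        \<Sum>i<length ts - 1. ennreal (dist (\<gamma> (ts ! i)) (\<gamma> (ts ! Suc i))))"

text \<open>In the first condition an unbounded domain has infinite diameter (the library's
  \<^term>\<open>diameter\<close> is real-valued). In the second one the distance to an empty boundary is infinite,
  whereas \<^term>\<open>infdist\<close> would return 0.\<close>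

definition one_sided_NTA :: "real \<Rightarrow> 'a::euclidean_space set \<Rightarrow> bool" where
  "one_sided_NTA K \<Omega> \<longleftrightarrow>
     open \<Omega> \<and> connected \<Omega> \<and> \<Omega> \<noteq> {} \<and>
     (\<forall>x\<in>frontier \<Omega>. \<forall>r>0. (bounded \<Omega> \<longrightarrow> r < diameter \<Omega>) \<longrightarrow>
        (\<exists>y. ball y (r / K) \<subseteq> \<Omega> \<inter> ball x r)) \<and>
     (\<forall>x\<in>\<Omega>. \<forall>y\<in>\<Omega>. \<exists>\<gamma>. path \<gamma> \<and> path_image \<gamma> \<subseteq> \<Omega> \<and> pathstart \<gamma> = x \<and> pathfinish \<gamma> = y \<and>
        curve_length \<gamma> 0 1 \<le> ennreal (K * dist x y) \<and>
        (frontier \<Omega> \<noteq> {} \<longrightarrow>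
           (\<forall>t\<in>{0..1}. min (curve_length \<gamma> 0 t) (curve_length \<gamma> t 1)
                         \<le> ennreal (K * infdist (\<gamma> t) (frontier \<Omega>)))))"

text \<open>An element of \<open>C(S)\<close> is represented by any total function continuous on \<open>S\<close>; its values
  off \<open>S\<close> are irrelevant. A map \<open>H\<^sub>\<Omega> : C(\<Omega>) \<times> C(\<partial>\<Omega>) \<rightarrow> C(closure \<Omega>)\<close> is thus a function on
  total functions whose result, on \<open>closure \<Omega>\<close>, depends only on the restrictions of its
  arguments to \<open>\<Omega>\<close> and \<open>\<partial>\<Omega>\<close>.\<close>

type_synonym 'a sol_op = "'a set \<Rightarrow> ('a \<Rightarrow> real) \<Rightarrow> ('a \<Rightarrow> real) \<Rightarrow> 'a \<Rightarrow> real"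

definition solution_family :: "'a::euclidean_space set set \<Rightarrow> 'a sol_op \<Rightarrow> bool" where
  "solution_family Q H \<longleftrightarrow>
     (\<forall>\<Omega>\<in>Q. open \<Omega>) \<and>
     (\<forall>\<Omega>\<in>Q. \<forall>f g. continuous_on \<Omega> f \<longrightarrow> continuous_on (frontier \<Omega>) g \<longrightarrow>
        continuous_on (closure \<Omega>) (H \<Omega> f g)) \<and>
     (\<forall>\<Omega>\<in>Q. \<forall>f g f' g'.
        continuous_on \<Omega> f \<longrightarrow> continuous_on (frontier \<Omega>) g \<longrightarrow>
        (\<forall>x\<in>\<Omega>. f x = f' x) \<longrightarrow> (\<forall>x\<in>frontier \<Omega>. g x = g' x) \<longrightarrow>
        (\<forall>x\<in>closure \<Omega>. H \<Omega> f g x = H \<Omega> f' g' x))"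

definition nonneg_solutions :: "'a::euclidean_space sol_op \<Rightarrow> 'a set \<Rightarrow> ('a \<Rightarrow> real) set" where
  "nonneg_solutions H U =
     {u. continuous_on (closure U) u \<and> (\<forall>x\<in>closure U. u x \<ge> 0) \<and>
         (\<exists>f. continuous_on U f \<and> (\<forall>x\<in>U. H U f u x = u x))}"

text \<open>\<open>W x r\<close> is the localized set \<open>U\<^bsub>x,r\<^esub>\<close>; the family \<open>W\<close> is fixed once and for all and
  the approximation and boundary Harnack properties refer to this family.\<close>

definition localization ::
  "'a::euclidean_space set set \<Rightarrow> 'a set \<Rightarrow> ('a \<Rightarrow> real \<Rightarrow> 'a set) \<Rightarrow> bool" where
  "localization Q U W \<longleftrightarrow>
     (\<forall>r>0. \<forall>x\<in>closure U.
        W x r \<in> Q \<and> W x r \<subseteq> ball x (2 * r) \<and> U \<inter> ball x r = W x r \<inter> ball x r)"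

definition homogeneity :: "'a::euclidean_space set set \<Rightarrow> 'a sol_op \<Rightarrow> bool" where
  "homogeneity Q H \<longleftrightarrow> (\<forall>\<Omega>\<in>Q. \<forall>x\<in>closure \<Omega>. H \<Omega> (\<lambda>_. 0) (\<lambda>_. 0) x = 0)"

definition solvability :: "'a::euclidean_space set set \<Rightarrow> 'a sol_op \<Rightarrow> bool" where
  "solvability Q H \<longleftrightarrow>
     (\<forall>\<Omega>\<in>Q. \<forall>f g. continuous_on \<Omega> f \<longrightarrow> continuous_on (frontier \<Omega>) g \<longrightarrow>
        (\<forall>x\<in>frontier \<Omega>. H \<Omega> f g x = g x))"

definition extension :: "'a::euclidean_space set set \<Rightarrow> 'a sol_op \<Rightarrow> bool" where
  "extension Q H \<longleftrightarrow>
     (\<forall>\<Omega>\<in>Q. \<forall>\<Omega>'\<in>Q. \<Omega> \<subseteq> \<Omega>' \<longrightarrow>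
        (\<forall>f g. continuous_on \<Omega>' f \<longrightarrow> continuous_on (frontier \<Omega>') g \<longrightarrow>
           (\<forall>x\<in>\<Omega>. H \<Omega> f (H \<Omega>' f g) x = H \<Omega>' f g x)))"

definition comparison :: "'a::euclidean_space set set \<Rightarrow> 'a sol_op \<Rightarrow> bool" where
  "comparison Q H \<longleftrightarrow>
     (\<forall>\<Omega>\<in>Q. \<forall>f\<^sub>1 f\<^sub>2 g\<^sub>1 g\<^sub>2.
        continuous_on \<Omega> f\<^sub>1 \<longrightarrow> continuous_on \<Omega> f\<^sub>2 \<longrightarrow>
        continuous_on (frontier \<Omega>) g\<^sub>1 \<longrightarrow> continuous_on (frontier \<Omega>) g\<^sub>2 \<longrightarrow>
        (\<forall>x\<in>\<Omega>. f\<^sub>1 x \<ge> f\<^sub>2 x) \<longrightarrow> (\<forall>x\<in>frontier \<Omega>. g\<^sub>1 x \<le> g\<^sub>2 x) \<longrightarrow>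
        (\<forall>x\<in>closure \<Omega>. H \<Omega> f\<^sub>1 g\<^sub>1 x \<le> H \<Omega> f\<^sub>2 g\<^sub>2 x))"

text \<open>The inequality evaluates \<open>u \<in> C(closure U)\<close> on \<open>W x r\<close> and on its boundary, so it presupposes
  \<open>W x r \<subseteq> closure U\<close>. With total functions this presupposition has to be stated.\<close>

definition approximation_property ::
  "'a::euclidean_space sol_op \<Rightarrow> 'a set \<Rightarrow> ('a \<Rightarrow> real \<Rightarrow> 'a set) \<Rightarrow> ('a \<Rightarrow> real) set
     \<Rightarrow> real \<Rightarrow> real \<Rightarrow> bool" where
  "approximation_property H U W V C\<^sub>1 \<zeta> \<longleftrightarrow>
     (\<forall>x\<in>closure U. \<forall>r. 0 < r \<and> r \<le> 1/4 \<and> x \<in> ball 0 (1/2) \<inter> frontier (W x r) \<longrightarrow>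
        W x r \<subseteq> closure U \<and>
        (\<forall>u\<in>V. \<forall>y\<in>W x r. \<bar>u y - H (W x r) (\<lambda>_. 0) u y\<bar> \<le> C\<^sub>1 * r powr \<zeta>))"

definition harnack ::
  "'a::euclidean_space set \<Rightarrow> ('a \<Rightarrow> real) set \<Rightarrow> real \<Rightarrow> bool" where
  "harnack U V C\<^sub>2 \<longleftrightarrow>
     (\<forall>u\<in>V. \<forall>x. \<forall>r>0. ball x (2 * r) \<subseteq> U \<longrightarrow>
        (SUP y\<in>ball x r. u y) \<le> C\<^sub>2 * ((INF y\<in>ball x r. u y) + 1))"

text \<open>The inequality is required only where both quotients are defined.\<close>

definition boundary_harnack ::
  "'a::euclidean_space sol_op \<Rightarrow> 'a set \<Rightarrow> ('a \<Rightarrow> real \<Rightarrow> 'a set) \<Rightarrow> real \<Rightarrow> real \<Rightarrow> bool" where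
  "boundary_harnack H U W C\<^sub>3 \<alpha> \<longleftrightarrow>
     (\<forall>a\<in>frontier U. \<forall>r>0. \<forall>u\<^sub>1 u\<^sub>2.
        continuous_on (closure (W a r)) u\<^sub>1 \<longrightarrow> continuous_on (closure (W a r)) u\<^sub>2 \<longrightarrow>
        (\<forall>x\<in>W a r. H (W a r) (\<lambda>_. 0) u\<^sub>1 x = u\<^sub>1 x \<and> H (W a r) (\<lambda>_. 0) u\<^sub>2 x = u\<^sub>2 x \<and>
                    u\<^sub>1 x \<ge> 0 \<and> u\<^sub>2 x \<ge> 0) \<longrightarrow>
        (\<forall>x\<in>frontier U \<inter> ball a r. u\<^sub>1 x = 0 \<and> u\<^sub>2 x = 0) \<longrightarrow>
        (\<forall>x\<in>U \<inter> ball a (r/2). \<forall>y\<in>U \<inter> ball a (r/2). u\<^sub>2 x \<noteq> 0 \<longrightarrow> u\<^sub>2 y \<noteq> 0 \<longrightarrow>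
           u\<^sub>1 x / u\<^sub>2 x \<le> (1 + C\<^sub>3 * (dist x y powr \<alpha> / r powr \<alpha>)) * (u\<^sub>1 y / u\<^sub>2 y)))"

end

theory Submission
  imports Defs
begin

text \<open>Near a boundary point \<open>a\<close>, replacing \<open>u\<^sub>i\<close> at scale \<open>t\<close> by the solution with zero right-hand side
  costs \<open>C\<^sub>1 t\<^sup>\<zeta>\<close>, which by the lower bound \<open>u\<^sub>i \<ge> C\<^sub>4 d\<^sup>\<beta>\<close> is a small relative error at points with
  distance at least about \<open>t\<^bsup>p^2\<^esup>\<close> from the boundary, where \<open>p > 1\<close> and \<open>\<beta> p\<^sup>2 < \<zeta>\<close>. The boundary
  Harnack inequality then compares \<open>u\<^sub>1 / u\<^sub>2\<close> at such a point with its value at a corkscrew point at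
  scale \<open>t\<^sup>p\<close>, up to a factor \<open>1 + O(t\<^sup>\<delta>)\<close>. Iterating \<open>t \<mapsto> t\<^bsup>1/p\<^esup>\<close> leads to a fixed scale; along these
  scales the product of the factors is bounded, which it would not be for geometric scales. At the
  fixed scale a Harnack chain from \<open>x\<^sub>0\<close> bounds \<open>u\<^sub>1\<close>, and the lower bound on \<open>u\<^sub>2\<close> concludes.\<close>

section \<open>Curve length and chains of bounded step size\<close>

text \<open>Prefixing the vertices \<open>s\<close>, \<open>t\<close> to a polygon inscribed in
  \<open>{t..b}\<close> gives one inscribed in \<open>{s..b}\<close> that is longer by at least the
  chord. This half of additivity lets a chain pay for its steps out of the remaining length.\<close>

lemma curve_length_prepend:
  fixes \<gamma> :: "real \<Rightarrow> 'a::metric_space"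
  assumes "s \<le> t" "t \<le> b"
  shows "ennreal (dist (\<gamma> s) (\<gamma> t)) + curve_length \<gamma> t b \<le> curve_length \<gamma> s b"
proof -
  let ?len = "\<lambda>ts. \<Sum>i<length ts - 1. ennreal (dist (\<gamma> (ts ! i)) (\<gamma> (ts ! Suc i)))"
  let ?P = "\<lambda>s. {ts. sorted ts \<and> set ts \<subseteq> {s..b}}"
  have *: "ennreal (dist (\<gamma> s) (\<gamma> t)) + ?len ts \<le> curve_length \<gamma> s b" if "ts \<in> ?P t" for ts
  proof -
    have "s # t # ts \<in> ?P s" using that assms by auto
    then have "?len (s # t # ts) \<le> curve_length \<gamma> s b"
      unfolding curve_length_def by (rule SUP_upper)
    moreover have "ennreal (dist (\<gamma> s) (\<gamma> t)) + ?len ts \<le> ?len (s # t # ts)"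
    proof (cases ts)
      case (Cons u us)
      then show ?thesis by (simp add: sum.lessThan_Suc_shift del: sum.lessThan_Suc)
    qed simp
    ultimately show ?thesis by order
  qed
  have "?P t \<noteq> {}" by (auto intro: exI[of _ "[]"])
  then have "ennreal (dist (\<gamma> s) (\<gamma> t)) + curve_length \<gamma> t b
      = (SUP ts\<in>?P t. ennreal (dist (\<gamma> s) (\<gamma> t)) + ?len ts)"
    unfolding curve_length_def by (rule ennreal_SUP_add_right)
  also have "\<dots> \<le> curve_length \<gamma> s b" by (intro SUP_least *)
  finally show ?thesis .
qed

lemma dist_le_curve_length:
  fixes \<gamma> :: "real \<Rightarrow> 'a::metric_space"
  assumes "a \<le> b"
  shows "ennreal (dist (\<gamma> a) (\<gamma> b)) \<le> curve_length \<gamma> a b"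
  using curve_length_prepend[of a b b \<gamma>] assms
  by (meson add_increasing2 le_iff_add order_refl order_trans zero_le)

text \<open>The chain is greedy: while \<open>\<gamma> 1\<close> is farther than
  \<open>\<rho>\<close>, the intermediate value theorem gives a later point at distance exactly
  \<open>\<rho>\<close>, and moving there uses up at least \<open>\<rho>\<close> of the remaining
  length. This happens at most \<open>N\<close> times; the last, shorter step accounts for the
  exponent \<open>Suc N\<close>. If the chain ends early, \<open>pos\<close> allows the exponent to
  be raised.\<close>

lemma chain_along_curve:
  fixes \<gamma> :: "real \<Rightarrow> 'a::metric_space" and w :: "'a \<Rightarrow> real"
  assumes cont: "continuous_on {0..1} \<gamma>" and "\<rho> > 0" "E \<ge> 1"
    and pos: "\<And>t. t \<in> {0..1} \<Longrightarrow> 0 \<le> w (\<gamma> t)"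
    and step: "\<And>t t'. t \<in> {0..1} \<Longrightarrow> t' \<in> {0..1} \<Longrightarrow> dist (\<gamma> t) (\<gamma> t') \<le> \<rho> \<Longrightarrow> w (\<gamma> t') \<le> E * w (\<gamma> t)"
    and "s \<in> {0..1}" "curve_length \<gamma> s 1 \<le> ennreal (real N * \<rho>)"
  shows "w (\<gamma> 1) \<le> E ^ Suc N * w (\<gamma> s)"
  using assms(6,7)
proof (induction N arbitrary: s)
  case 0
  then have "ennreal (dist (\<gamma> s) (\<gamma> 1)) \<le> 0"
    using dist_le_curve_length[of s 1 \<gamma>] by auto
  then have "dist (\<gamma> s) (\<gamma> 1) \<le> \<rho>" using \<open>\<rho> > 0\<close> by simp
  then show ?case using step[of s 1] 0 by simp
next
  case (Suc N)
  show ?case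
  proof (cases "dist (\<gamma> s) (\<gamma> 1) \<le> \<rho>")
    case True
    have "w (\<gamma> 1) \<le> E ^ 1 * w (\<gamma> s)" using step[of s 1] True Suc.prems by simp
    also have "\<dots> \<le> E ^ Suc (Suc N) * w (\<gamma> s)"
      using \<open>E \<ge> 1\<close> pos[OF Suc.prems(1)] by (intro mult_right_mono power_increasing) auto
    finally show ?thesis .
  next
    case False
    have "continuous_on {s..1} (\<lambda>t. dist (\<gamma> s) (\<gamma> t))"
      using Suc.prems by (intro continuous_intros continuous_on_subset[OF cont]) auto
    then obtain t where t: "s \<le> t" "t \<le> 1" "dist (\<gamma> s) (\<gamma> t) = \<rho>"
      using IVT'[of "\<lambda>t. dist (\<gamma> s) (\<gamma> t)" s \<rho> 1] False \<open>\<rho> > 0\<close> Suc.prems by auto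
    have "ennreal \<rho> + curve_length \<gamma> t 1 \<le> ennreal (real (Suc N) * \<rho>)"
      using curve_length_prepend[of s t 1 \<gamma>] t Suc.prems by auto
    also have "\<dots> = ennreal \<rho> + ennreal (real N * \<rho>)"
      using \<open>\<rho> > 0\<close> by (subst ennreal_plus[symmetric]) (auto simp: algebra_simps)
    finally have "curve_length \<gamma> t 1 \<le> ennreal (real N * \<rho>)"
      by simp
    then have "w (\<gamma> 1) \<le> E ^ Suc N * w (\<gamma> t)" using Suc.IH[of t] t Suc.prems by auto
    also have "\<dots> \<le> E ^ Suc N * (E * w (\<gamma> s))"
      using step[of s t] t Suc.prems \<open>E \<ge> 1\<close> by (intro mult_left_mono) auto
    finally show ?thesis by (simp add: algebra_simps)
  qed
qed

section \<open>Distance to the boundary, NTA curves and Harnack chains\<close>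

text \<open>A ball is connected, so if it meets both \<open>U\<close> and its complement it contains
  a frontier point.\<close>

lemma ball_subset_if_infdist_frontier:
  fixes U :: "'a::euclidean_space set"
  assumes "z \<in> U" "infdist z (frontier U) \<ge> \<delta>"
  shows "ball z \<delta> \<subseteq> U"
proof (rule ccontr)
  assume "\<not> ball z \<delta> \<subseteq> U"
  then have "ball z \<delta> - U \<noteq> {}" "0 < \<delta>"
    using ball_empty[of \<delta> z] by (blast, fastforce)
  moreover from \<open>0 < \<delta>\<close> have "ball z \<delta> \<inter> U \<noteq> {}"
    using assms(1) centre_in_ball[of z \<delta>] by blast
  ultimately obtain w where "w \<in> ball z \<delta>" "w \<in> frontier U"
    using connected_Int_frontier[OF connected_ball] by blast
  then show False using infdist_le[of w "frontier U" z] assms(2) by auto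
qed

lemma le_infdist_frontier:
  fixes U :: "'a::euclidean_space set"
  assumes "open U" "frontier U \<noteq> {}" "ball y \<delta> \<subseteq> U"
  shows "\<delta> \<le> infdist y (frontier U)"
  unfolding infdist_notempty[OF assms(2)]
proof (rule cINF_greatest[OF assms(2)])
  fix z assume "z \<in> frontier U"
  then have "z \<notin> U" using assms(1) by (simp add: frontier_def interior_open)
  then show "\<delta> \<le> dist y z" using assms(3) by (meson in_mono mem_ball not_le)
qed

text \<open>Arcs are at least as long as their chords, so by (D2) a curve point at distance d from
  the boundary is within K d of one end point. The distance to the boundary is 1-Lipschitz, hence m
  \<le> (1 + K) d \<le> 2 max(1, K) d.\<close>

lemma NTA_curve:
  fixes U :: "'a::euclidean_space set"
  assumes nta: "one_sided_NTA K U" and "frontier U \<noteq> {}" "K > 0" "x \<in> U" "y \<in> U"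
    and x: "m \<le> infdist x (frontier U)" and y: "m \<le> infdist y (frontier U)"
  obtains \<gamma> where "continuous_on {0..1} \<gamma>" "\<gamma> 0 = x" "\<gamma> 1 = y"
    "curve_length \<gamma> 0 1 \<le> ennreal (K * dist x y)"
    "\<And>t. t \<in> {0..1} \<Longrightarrow> \<gamma> t \<in> U"
    "\<And>t. t \<in> {0..1} \<Longrightarrow> m / (2 * max 1 K) \<le> infdist (\<gamma> t) (frontier U)"
proof -
  obtain \<gamma> where \<gamma>: "path \<gamma>" "path_image \<gamma> \<subseteq> U" "pathstart \<gamma> = x" "pathfinish \<gamma> = y"
    "curve_length \<gamma> 0 1 \<le> ennreal (K * dist x y)"
    "\<forall>t\<in>{0..1}. min (curve_length \<gamma> 0 t) (curve_length \<gamma> t 1)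
                         \<le> ennreal (K * infdist (\<gamma> t) (frontier U))"
    using nta \<open>frontier U \<noteq> {}\<close> \<open>x \<in> U\<close> \<open>y \<in> U\<close> unfolding one_sided_NTA_def by meson
  have ends: "\<gamma> 0 = x" "\<gamma> 1 = y" using \<gamma> by (auto simp: pathstart_def pathfinish_def)
  show ?thesis
  proof (rule that)
    fix t :: real assume t: "t \<in> {0..1}"
    let ?d = "infdist (\<gamma> t) (frontier U)"
    have "ennreal (min (dist x (\<gamma> t)) (dist (\<gamma> t) y)) = min (ennreal (dist x (\<gamma> t))) (ennreal (dist (\<gamma> t) y))"
      by (simp add: min_ennreal)
    also have "\<dots> \<le> min (curve_length \<gamma> 0 t) (curve_length \<gamma> t 1)"
      using dist_le_curve_length[of 0 t \<gamma>] dist_le_curve_length[of t 1 \<gamma>] t ends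
      by (intro min.mono) auto
    also have "\<dots> \<le> ennreal (K * ?d)" using \<gamma> t by auto
    finally have "min (dist x (\<gamma> t)) (dist (\<gamma> t) y) \<le> K * ?d"
      using \<open>K > 0\<close> by (simp add: infdist_nonneg)
    moreover have "m \<le> ?d + dist x (\<gamma> t)" using infdist_triangle[of x "frontier U" "\<gamma> t"] x by auto
    moreover have "m \<le> ?d + dist (\<gamma> t) y"
      using infdist_triangle[of y "frontier U" "\<gamma> t"] y by (auto simp: dist_commute)
    ultimately have "m \<le> ?d + K * ?d" by linarith
    also have "\<dots> \<le> max 1 K * ?d + max 1 K * ?d"
      using mult_right_mono[of 1 "max 1 K" ?d] mult_right_mono[of K "max 1 K" ?d]
      by (auto simp: infdist_nonneg)
    finally show "m / (2 * max 1 K) \<le> ?d" by (simp add: field_simps)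
  qed (use \<gamma> ends in \<open>auto simp: path_def path_image_def\<close>)
qed

text \<open>The additive 1 in the Harnack property is absorbed by passing to \<open>u + 1\<close>,
  which satisfies a purely multiplicative inequality that can be iterated. The factor
  \<open>\<bar>C\<bar> + 1\<close> allows for either sign of \<open>C\<close>.\<close>

lemma harnack_pointwise:
  fixes U :: "'a::euclidean_space set"
  assumes "harnack U V C" "V \<subseteq> nonneg_solutions H U" "u \<in> V" "ball x (2 * r) \<subseteq> U" "y \<in> ball x r"
  shows "u y + 1 \<le> (\<bar>C\<bar> + 1) * (u x + 1)"
proof -
  have "r > 0" using assms(5) by (auto intro: le_less_trans[OF zero_le_dist])
  have sub: "ball x r \<subseteq> U" using assms(4) \<open>r > 0\<close> subset_ball[of r "2 * r" x] by auto
  have u: "continuous_on (closure U) u" "\<forall>x\<in>closure U. u x \<ge> 0"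
    using assms(2,3) by (auto simp: nonneg_solutions_def)
  \<comment> \<open>Compactness of the closed ball bounds \<open>u\<close>; the real-valued
    \<open>SUP\<close> and \<open>INF\<close> are informative only for bounded sets.\<close>
  have "cball x r \<subseteq> closure U"
    using closure_mono[OF sub] \<open>r > 0\<close> by (simp add: closure_ball)
  then have "compact (u ` cball x r)"
    by (intro compact_continuous_image continuous_on_subset[OF u(1)]) auto
  then have bdd: "bdd_above (u ` ball x r)" "bdd_below (u ` ball x r)"
    by (meson ball_subset_cball bounded_imp_bdd_above bounded_imp_bdd_below bounded_subset
        compact_imp_bounded image_mono)+
  have nn: "u z \<ge> 0" if "z \<in> ball x r" for z using u(2) sub that closure_subset by blast
  have xb: "x \<in> ball x r" using \<open>r > 0\<close> by simp
  have I: "(INF y\<in>ball x r. u y) \<le> u x" "0 \<le> (INF y\<in>ball x r. u y)"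
    using bdd xb nn by (auto intro!: cINF_lower cINF_greatest)
  have "u y \<le> (SUP y\<in>ball x r. u y)" using bdd assms(5) by (intro cSUP_upper)
  also have "\<dots> \<le> C * ((INF y\<in>ball x r. u y) + 1)"
    using assms(1,3,4) \<open>r > 0\<close> by (auto simp: harnack_def)
  also have "\<dots> \<le> \<bar>C\<bar> * (u x + 1)" using I by (intro mult_mono) auto
  finally show ?thesis using nn[OF xb] by (simp add: algebra_simps)
qed

text \<open>The constant is chosen before \<open>U\<close>, \<open>V\<close> and \<open>u\<close>:
  the number of steps depends only on the maximal curve length \<open>K * D\<close> and on the step
  size, which \<open>m\<close> and \<open>K\<close> determine.\<close>

lemma harnack_NTA:
  fixes K C m D :: real
  assumes "K > 0" "m > 0"
  shows "\<exists>M>0. \<forall>(U :: 'a::euclidean_space set) V H u x y.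
    harnack U V C \<longrightarrow> V \<subseteq> nonneg_solutions H U \<longrightarrow> u \<in> V \<longrightarrow> one_sided_NTA K U \<longrightarrow>
    frontier U \<noteq> {} \<longrightarrow> x \<in> U \<longrightarrow> y \<in> U \<longrightarrow> m \<le> infdist x (frontier U) \<longrightarrow>
    m \<le> infdist y (frontier U) \<longrightarrow> dist x y \<le> D \<longrightarrow> u y + 1 \<le> M * (u x + 1)"
proof -
  define \<delta> where "\<delta> = m / (2 * max 1 K)"
  \<comment> \<open>Along the curve the distance to the boundary is at least
    \<open>\<delta>\<close>. A step below \<open>\<delta> / 2\<close> stays in a ball whose double
    lies in \<open>U\<close>.\<close>
  define \<rho> where "\<rho> = \<delta> / 4"
  define N where "N = nat \<lceil>K * D / \<rho>\<rceil>"
  define M where "M = (\<bar>C\<bar> + 1) ^ Suc N"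
  have "\<delta> > 0" "\<rho> > 0" using assms by (auto simp: \<delta>_def \<rho>_def)
  have "K * D / \<rho> \<le> real N" unfolding N_def by linarith
  then have N: "K * D \<le> real N * \<rho>" using \<open>\<rho> > 0\<close> by (simp add: field_simps)
  have "u y + 1 \<le> M * (u x + 1)"
    if h: "harnack U V C" "V \<subseteq> nonneg_solutions H U" "u \<in> V" "one_sided_NTA K U"
    "frontier U \<noteq> {}" "x \<in> U" "y \<in> U" "m \<le> infdist x (frontier U)"
    "m \<le> infdist y (frontier U)" "dist x y \<le> D" for U :: "'a set" and V H u x y
  proof -
    obtain \<gamma> where \<gamma>: "continuous_on {0..1} \<gamma>" "\<gamma> 0 = x" "\<gamma> 1 = y"
      "curve_length \<gamma> 0 1 \<le> ennreal (K * dist x y)"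
      "\<And>t. t \<in> {0..1} \<Longrightarrow> \<gamma> t \<in> U"
      "\<And>t. t \<in> {0..1} \<Longrightarrow> \<delta> \<le> infdist (\<gamma> t) (frontier U)"
      using NTA_curve[OF h(4,5) \<open>K > 0\<close> h(6-9)] unfolding \<delta>_def by metis
    have len: "curve_length \<gamma> 0 1 \<le> ennreal (real N * \<rho>)"
      using \<gamma>(4) N mult_left_mono[OF h(10), of K] \<open>K > 0\<close>
      by (meson ennreal_leI less_imp_le order_trans)
    have "u (\<gamma> 1) + 1 \<le> (\<bar>C\<bar> + 1) ^ Suc N * (u (\<gamma> 0) + 1)"
    proof (rule chain_along_curve[OF \<gamma>(1) \<open>\<rho> > 0\<close>, where w = "\<lambda>z. u z + 1", OF _ _ _ _ len])
      fix t :: real assume "t \<in> {0..1}"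
      then have "\<gamma> t \<in> closure U" using \<gamma>(5) closure_subset by blast
      then show "0 \<le> u (\<gamma> t) + 1" using h(2,3) by (fastforce simp: nonneg_solutions_def)
    next
      fix t t' :: real assume t: "t \<in> {0..1}" "t' \<in> {0..1}" "dist (\<gamma> t) (\<gamma> t') \<le> \<rho>"
      have "ball (\<gamma> t) (2 * (\<delta> / 2)) \<subseteq> U"
        using ball_subset_if_infdist_frontier[of "\<gamma> t" U \<delta>] \<gamma> t by auto
      moreover have "\<gamma> t' \<in> ball (\<gamma> t) (\<delta> / 2)" using t \<open>\<delta> > 0\<close> by (auto simp: \<rho>_def)
      ultimately show "u (\<gamma> t') + 1 \<le> (\<bar>C\<bar> + 1) * (u (\<gamma> t) + 1)"
        by (rule harnack_pointwise[OF h(1-3)])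
    qed auto
    then show ?thesis by (simp add: M_def \<gamma>)
  qed
  moreover have "M > 0" by (simp add: M_def add_nonneg_pos)
  ultimately show ?thesis by blast
qed


section \<open>Real estimates for the iteration over scales\<close>

lemma powr_times_const_small:
  fixes B e :: real
  assumes "e > 0"
  shows "\<exists>b>0. \<forall>t. 0 < t \<and> t < b \<longrightarrow> B * t powr e \<le> 1/2"
proof -
  define b where "b = (1 / (2 * (\<bar>B\<bar> + 1))) powr (1 / e)"
  have "B * t powr e \<le> 1/2" if "0 < t" "t < b" for t
  proof -
    have "t powr e \<le> b powr e" using that assms by (intro powr_mono2) auto
    also have "\<dots> = 1 / (2 * (\<bar>B\<bar> + 1))" using assms by (simp add: b_def powr_powr)
    finally have "(\<bar>B\<bar> + 1) * t powr e \<le> 1/2" by (simp add: field_simps)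
    moreover have "B * t powr e \<le> (\<bar>B\<bar> + 1) * t powr e" by (intro mult_right_mono) auto
    ultimately show ?thesis by linarith
  qed
  moreover have "b > 0" by (auto simp: b_def)
  ultimately show ?thesis by blast
qed

text \<open>Passing from t to its p-th root divides the negative number \<open>ln t\<close> by
  \<open>p\<close>, so after finitely many steps it is at least \<open>ln T\<close>, while the scale
  stays below 1.\<close>

lemma powr_scale_induct:
  fixes p T :: real
  assumes "p > 1" "0 < T" "T < 1"
    and base: "\<And>t. T \<le> t \<Longrightarrow> t < 1 \<Longrightarrow> P t"
    and step: "\<And>t. 0 < t \<Longrightarrow> t < T \<Longrightarrow> P (t powr (1/p)) \<Longrightarrow> P t"
    and t: "0 < t" "t < 1"
  shows "P t"
proof -
  have *: "P t" if "0 < t" "t < 1" "p ^ k * ln T \<le> ln t" for t k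
    using that
  proof (induction k arbitrary: t)
    case 0
    then show ?case using base[of t] \<open>0 < T\<close> by simp
  next
    case (Suc k)
    show ?case
    proof (cases "T \<le> t")
      case False
      have "P (t powr (1/p))"
      proof (rule Suc.IH)
        have "ln t / p < 0" using Suc.prems \<open>p > 1\<close> by (simp add: divide_neg_pos)
        then show "t powr (1/p) < 1" using Suc.prems \<open>p > 1\<close> by (simp add: powr_def)
        show "p ^ k * ln T \<le> ln (t powr (1/p))"
          using Suc.prems \<open>p > 1\<close> by (simp add: ln_powr field_simps)
      qed (use Suc.prems in auto)
      then show ?thesis using step[of t] False Suc.prems by auto
    qed (use base Suc.prems in auto)
  qed
  have "ln T < 0" using assms by simp
  obtain k where "ln t / ln T < p ^ k" using real_arch_pow[OF \<open>p > 1\<close>] by blast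
  then have "p ^ k * ln T \<le> ln t" using \<open>ln T < 0\<close> by (simp add: field_simps)
  then show ?thesis using * t by blast
qed

text \<open>A relative error \<open>e\<close> costs at most \<open>exp e\<close> in one direction
  and, since 1 \<le> (1 + 2e)(1 - e) for e \<le> 1/2, at most \<open>exp (2 * e)\<close> in the
  other. Each of the two quotients thus loses \<open>exp (3 * e)\<close>. Exponentials make the
  losses of successive scales add up.\<close>

lemma ratio_perturb:
  fixes e :: real
  assumes "0 \<le> e" "e \<le> 1/2"
    and pos: "0 < x\<^sub>1" "0 < x\<^sub>2" "0 < y\<^sub>1" "0 < y\<^sub>2"
    and near: "\<bar>x\<^sub>1 - h\<^sub>1\<bar> \<le> e * x\<^sub>1" "\<bar>x\<^sub>2 - h\<^sub>2\<bar> \<le> e * x\<^sub>2" "\<bar>y\<^sub>1 - k\<^sub>1\<bar> \<le> e * y\<^sub>1" "\<bar>y\<^sub>2 - k\<^sub>2\<bar> \<le> e * y\<^sub>2"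
    and le: "h\<^sub>1 / h\<^sub>2 \<le> F * (k\<^sub>1 / k\<^sub>2)" and "F \<ge> 0"
  shows "x\<^sub>1 / x\<^sub>2 \<le> exp (6 * e) * F * (y\<^sub>1 / y\<^sub>2)"
proof -
  have up: "b \<le> exp e * a" and low: "a \<le> exp (2 * e) * b" and bpos: "0 < b"
    if "0 < a" "\<bar>a - b\<bar> \<le> e * a" for a b :: real
  proof -
    have "b \<le> (1 + e) * a" using that by (auto simp: algebra_simps)
    also have "\<dots> \<le> exp e * a" using that by (intro mult_right_mono) auto
    finally show "b \<le> exp e * a" .
    have l: "(1 - e) * a \<le> b" using that by (auto simp: algebra_simps)
    moreover have "0 < (1 - e) * a" using that assms by simp
    ultimately show "0 < b" by simp
    have "0 \<le> e * (1 - 2 * e)" using assms by simp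
    then have "1 \<le> (1 + 2 * e) * (1 - e)" by (simp add: algebra_simps)
    then have "1 * a \<le> (1 + 2 * e) * (1 - e) * a" using that by (intro mult_right_mono) auto
    also have "\<dots> \<le> (1 + 2 * e) * b" using l assms by (simp add: mult.assoc mult_left_mono)
    also have "\<dots> \<le> exp (2 * e) * b" using \<open>0 < b\<close> by (intro mult_right_mono) auto
    finally show "a \<le> exp (2 * e) * b" by simp
  qed
  have pos': "0 < h\<^sub>1" "0 < h\<^sub>2" "0 < k\<^sub>1" "0 < k\<^sub>2" using bpos pos near by blast+
  have "x\<^sub>1 / x\<^sub>2 \<le> (exp (2 * e) * h\<^sub>1) / (h\<^sub>2 / exp e)"
    using low[OF pos(1) near(1)] up[OF pos(2) near(2)] pos pos'
    by (intro frac_le) (auto simp: field_simps)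
  also have "\<dots> = exp (3 * e) * (h\<^sub>1 / h\<^sub>2)" by (simp add: exp_add[symmetric])
  also have "\<dots> \<le> exp (3 * e) * (F * (k\<^sub>1 / k\<^sub>2))" using le by (intro mult_left_mono) auto
  also have "k\<^sub>1 / k\<^sub>2 \<le> (exp e * y\<^sub>1) / (y\<^sub>2 / exp (2 * e))"
    using low[OF pos(4) near(4)] up[OF pos(3) near(3)] pos pos'
    by (intro frac_le) (auto simp: field_simps)
  also have "\<dots> = exp (3 * e) * (y\<^sub>1 / y\<^sub>2)" by (simp add: exp_add[symmetric])
  also have "exp (3 * e) * (F * (exp (3 * e) * (y\<^sub>1 / y\<^sub>2))) = exp (6 * e) * F * (y\<^sub>1 / y\<^sub>2)"
    by (simp add: exp_add[symmetric])
  finally show ?thesis using \<open>F \<ge> 0\<close> by (simp add: mult_left_mono)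
qed

section \<open>Comparison with solutions with zero right-hand side at one scale\<close>

locale boundary_harnack_setting =
  fixes Q :: "'a::euclidean_space set set" and H :: "'a sol_op" and U V W C\<^sub>1 C\<^sub>3 \<zeta> \<alpha>
  assumes fam: "solution_family Q H" and UQ: "U \<in> Q" and VU: "V \<subseteq> nonneg_solutions H U"
    and loc: "localization Q U W" and hom: "homogeneity Q H" and solv: "solvability Q H"
    and ext: "extension Q H" and comp: "comparison Q H"
    and approx: "approximation_property H U W V C\<^sub>1 \<zeta>"
    and bh: "boundary_harnack H U W C\<^sub>3 \<alpha>"
begin

lemma open_U: "open U"
  using fam UQ by (auto simp: solution_family_def)

text \<open>This makes \<open>h\<close> admissible in the boundary Harnack property. Comparison with
  the zero solution gives its sign, and solvability gives its boundary values.\<close>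

lemma approximant:
  fixes a :: 'a and r :: real and u :: "'a \<Rightarrow> real"
  defines "h \<equiv> H (W a r) (\<lambda>_. 0) u"
  assumes a: "a \<in> frontier U" "a \<in> ball 0 (1/2)" and r: "0 < r" "r \<le> 1/4" and u: "u \<in> V"
    and zero: "\<And>x. x \<in> frontier U \<inter> ball 0 1 \<Longrightarrow> u x = 0"
  shows "continuous_on (closure (W a r)) h"
    and "\<And>x. x \<in> W a r \<Longrightarrow> H (W a r) (\<lambda>_. 0) h x = h x \<and> 0 \<le> h x"
    and "\<And>x. x \<in> frontier U \<inter> ball a r \<Longrightarrow> h x = 0"
    and "\<And>x. x \<in> U \<inter> ball a r \<Longrightarrow> \<bar>u x - h x\<bar> \<le> C\<^sub>1 * r powr \<zeta>"
proof -
  let ?W = "W a r"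
  have acl: "a \<in> closure U" using a by (simp add: frontier_def)
  then have W: "?W \<in> Q" "U \<inter> ball a r = ?W \<inter> ball a r"
    using loc r by (auto simp: localization_def)
  have "open ?W" using fam W by (auto simp: solution_family_def)
  \<comment> \<open>\<open>U\<close> and \<open>?W\<close> agree in the ball, so their boundaries
    agree there. In particular \<open>a\<close> is a boundary point of \<open>?W\<close>, as the
    approximation property demands.\<close>
  have front: "frontier U \<inter> ball a r \<subseteq> frontier ?W"
  proof
    fix x assume x: "x \<in> frontier U \<inter> ball a r"
    then have "x \<in> closure (ball a r \<inter> U)"
      using open_Int_closure_subset[OF open_ball, of a r U] by (auto simp: frontier_def)
    then have "x \<in> closure ?W" using W(2) closure_mono[of "ball a r \<inter> U" ?W] by blast
    moreover have "x \<notin> U" using x open_U by (simp add: frontier_def interior_open)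
    then have "x \<notin> ?W" using x W(2) by blast
    ultimately show "x \<in> frontier ?W" using \<open>open ?W\<close> by (simp add: frontier_def interior_open)
  qed
  then have "a \<in> frontier ?W" using a r by auto
  then have app: "?W \<subseteq> closure U" "\<forall>y\<in>?W. \<bar>u y - h y\<bar> \<le> C\<^sub>1 * r powr \<zeta>"
    using approx acl a r u unfolding approximation_property_def h_def by blast+
  have "frontier ?W \<subseteq> closure U"
    using closure_minimal[OF app(1)] by (auto simp: frontier_def)
  then have uW: "continuous_on (frontier ?W) u" "\<forall>x\<in>frontier ?W. 0 \<le> u x"
    using u VU by (auto simp: nonneg_solutions_def intro: continuous_on_subset)
  show "continuous_on (closure ?W) h"
    using fam W uW unfolding solution_family_def h_def by auto
  show "H ?W (\<lambda>_. 0) h x = h x \<and> 0 \<le> h x" if "x \<in> ?W" for x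
  proof
    \<comment> \<open>The extension property is applied with both sets equal to \<open>?W\<close>:
      solving again with boundary data \<open>h\<close> reproduces \<open>h\<close>.\<close>
    show "H ?W (\<lambda>_. 0) h x = h x"
      using ext W uW that unfolding extension_def h_def by auto
    have x: "x \<in> closure ?W" using that closure_subset by blast
    have "H ?W (\<lambda>_. 0) (\<lambda>_. 0) x \<le> H ?W (\<lambda>_. 0) u x"
      using comp[unfolded comparison_def, rule_format, of ?W "\<lambda>_. 0" "\<lambda>_. 0" "\<lambda>_. 0" u x] W uW x
      by simp
    then show "0 \<le> h x" using hom W x by (auto simp: homogeneity_def h_def)
  qed
  show "h x = 0" if "x \<in> frontier U \<inter> ball a r" for x
  proof -
    have "h x = u x" using solv W uW front that unfolding solvability_def h_def by auto
    moreover have "norm x < 1"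
      using that a r norm_triangle_ineq[of "x - a" a] by (auto simp: dist_norm norm_minus_commute)
    ultimately show ?thesis using zero that by simp
  qed
  show "\<bar>u x - h x\<bar> \<le> C\<^sub>1 * r powr \<zeta>" if "x \<in> U \<inter> ball a r" for x
    using app W that by blast
qed

text \<open>The last hypothesis turns the absolute error of the approximation into a relative error
  \<open>e\<close> at both points, so the boundary Harnack inequality for the approximants passes to
  \<open>u\<^sub>1\<close> and \<open>u\<^sub>2\<close> by \<open>ratio_perturb\<close>. The number
  \<open>d\<close> bounds the Hoelder quotient.\<close>

lemma ratio_at_scale:
  assumes a: "a \<in> frontier U" "a \<in> ball 0 (1/2)" and r: "0 < r" "r \<le> 1/4"
    and x: "x \<in> U" "dist a x < r / 2" and y: "y \<in> U" "dist a y < r / 2"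
    and e: "0 \<le> e" "e \<le> 1/2" and d: "dist x y powr \<alpha> \<le> d * r powr \<alpha>"
    and u: "\<And>u. u \<in> {u\<^sub>1, u\<^sub>2} \<Longrightarrow> u \<in> V \<and> (\<forall>x\<in>frontier U \<inter> ball 0 1. u x = 0)
      \<and> 0 < u x \<and> 0 < u y \<and> C\<^sub>1 * r powr \<zeta> \<le> e * u x \<and> C\<^sub>1 * r powr \<zeta> \<le> e * u y"
  shows "u\<^sub>1 x / u\<^sub>2 x \<le> exp (6 * e + \<bar>C\<^sub>3\<bar> * d) * (u\<^sub>1 y / u\<^sub>2 y)"
proof -
  define h where "h u = H (W a r) (\<lambda>_. 0) u" for u
  have h: "continuous_on (closure (W a r)) (h u)"
    "\<And>x. x \<in> W a r \<Longrightarrow> H (W a r) (\<lambda>_. 0) (h u) x = h u x \<and> 0 \<le> h u x"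
    "\<And>x. x \<in> frontier U \<inter> ball a r \<Longrightarrow> h u x = 0"
    "\<And>x. x \<in> U \<inter> ball a r \<Longrightarrow> \<bar>u x - h u x\<bar> \<le> C\<^sub>1 * r powr \<zeta>"
    if "u \<in> {u\<^sub>1, u\<^sub>2}" for u
    using approximant[OF a r, of u] u[OF that] unfolding h_def by blast+
  have xy: "x \<in> U \<inter> ball a (r/2)" "y \<in> U \<inter> ball a (r/2)" "x \<in> U \<inter> ball a r" "y \<in> U \<inter> ball a r"
    using x y r by auto
  have near: "\<bar>u x - h u x\<bar> \<le> e * u x" "\<bar>u y - h u y\<bar> \<le> e * u y" if "u \<in> {u\<^sub>1, u\<^sub>2}" for u
    using h(4)[OF that xy(3)] h(4)[OF that xy(4)] u[OF that] by auto
  \<comment> \<open>As e \<le> 1/2, the approximants are at least half of \<open>u\<close>, so the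
    quotients in the boundary Harnack inequality are defined.\<close>
  have hpos: "0 < h u x" "0 < h u y" if "u \<in> {u\<^sub>1, u\<^sub>2}" for u
  proof -
    have "e * u x \<le> 1/2 * u x" "e * u y \<le> 1/2 * u y"
      using u[OF that] e by (intro mult_right_mono; simp)+
    then show "0 < h u x" "0 < h u y" using near[OF that] u[OF that] by linarith+
  qed
  define q where "q = dist x y powr \<alpha> / r powr \<alpha>"
  have "r powr \<alpha> > 0" using r by simp
  then have q: "0 \<le> q" "q \<le> d" using d by (auto simp: q_def field_simps)
  have "h u\<^sub>1 x / h u\<^sub>2 x \<le> (1 + C\<^sub>3 * q) * (h u\<^sub>1 y / h u\<^sub>2 y)"
    unfolding q_def
    by (rule bh[unfolded boundary_harnack_def, rule_format])
      (use a r h hpos[of u\<^sub>1] hpos[of u\<^sub>2] xy in auto)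
  also have "\<dots> \<le> exp (\<bar>C\<^sub>3\<bar> * d) * (h u\<^sub>1 y / h u\<^sub>2 y)"
  proof (intro mult_right_mono)
    have "C\<^sub>3 * q \<le> \<bar>C\<^sub>3\<bar> * d" using q by (intro mult_mono) auto
    then show "1 + C\<^sub>3 * q \<le> exp (\<bar>C\<^sub>3\<bar> * d)"
      using exp_ge_add_one_self[of "\<bar>C\<^sub>3\<bar> * d"] by linarith
  qed (use hpos[of u\<^sub>1] hpos[of u\<^sub>2] in auto)
  finally have "u\<^sub>1 x / u\<^sub>2 x \<le> exp (6 * e) * exp (\<bar>C\<^sub>3\<bar> * d) * (u\<^sub>1 y / u\<^sub>2 y)"
    using near u by (intro ratio_perturb[OF e]) auto
  then show ?thesis by (simp add: exp_add)
qed

end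


section \<open>Descent from scale to scale\<close>

text \<open>Below \<open>T\<close> one descent step works: \<open>T\<close> does not exceed the
  diameter, so (D1) applies, and the three smallness conditions give a relative error of at most
  1/2, points well inside the ball of radius t, and summable losses. \<open>B\<close> adds the loss
  of \<open>ratio_perturb\<close> to that of the Hoelder factor, and \<open>\<delta>\<close> is a
  common lower bound for their exponents.\<close>

locale boundary_harnack_pair = boundary_harnack_setting Q H U V W C\<^sub>1 C\<^sub>3 \<zeta> \<alpha>
  for Q :: "'a::euclidean_space set set" and H U V W C\<^sub>1 C\<^sub>3 \<zeta> \<alpha> +
  fixes u\<^sub>1 u\<^sub>2 :: "'a \<Rightarrow> real" and K C\<^sub>4 \<beta> p \<delta> B T :: real
  assumes nta: "one_sided_NTA K U" and params: "0 < K" "0 < C\<^sub>4" "0 < \<beta>" "0 < \<alpha>" "1 < p"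
    and \<delta>: "0 < \<delta>" "\<delta> \<le> \<zeta> - \<beta> * p\<^sup>2" "\<delta> \<le> (p - 1) * \<alpha>"
    and B: "B = 6 * (\<bar>C\<^sub>1\<bar> * max 1 K powr \<beta> / C\<^sub>4) + \<bar>C\<^sub>3\<bar> * 2 powr \<alpha>"
    and T: "0 < T" "T \<le> 1/4" "bounded U \<Longrightarrow> T \<le> diameter U"
    and small: "\<And>t. 0 < t \<Longrightarrow> t < T \<Longrightarrow> (\<bar>C\<^sub>1\<bar> * max 1 K powr \<beta> / C\<^sub>4) * t powr (\<zeta> - \<beta> * p\<^sup>2) \<le> 1/2"
      "\<And>t. 0 < t \<Longrightarrow> t < T \<Longrightarrow> 4 * t powr (p - 1) \<le> 1/2"
      "\<And>t. 0 < t \<Longrightarrow> t < T \<Longrightarrow> t powr (\<delta> * (p - 1)) \<le> 1/2"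
    and u: "\<And>u. u \<in> {u\<^sub>1, u\<^sub>2} \<Longrightarrow> u \<in> V \<and> (\<forall>x\<in>frontier U \<inter> ball 0 1. u x = 0)
      \<and> (\<forall>x\<in>U. C\<^sub>4 * infdist x (frontier U) powr \<beta> \<le> u x)"
begin

text \<open>Both \<open>x\<close> and \<open>y\<close> lie within about \<open>t\<^sup>p\<close> of \<open>a\<close>, much less than the scale \<open>t\<close> of the
  approximation, so the Hoelder factor in the boundary Harnack inequality is \<open>1 + o(1)\<close>; and
  \<open>\<beta> p\<^sup>2 < \<zeta>\<close> makes the approximation error \<open>C\<^sub>1 t\<^sup>\<zeta>\<close> negligible against the values of
  \<open>u\<^sub>1, u\<^sub>2\<close> at \<open>x\<close> and \<open>y\<close>.\<close>

lemma ratio_descent: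
  assumes a: "a \<in> frontier U" "a \<in> ball 0 (1/2)" and t: "0 < t" "t < T"
    and x: "x \<in> U" "dist a x \<le> t powr (p\<^sup>2)" "t powr (p\<^sup>2) / max 1 K \<le> infdist x (frontier U)"
  obtains y where "y \<in> U" "dist a y \<le> t powr p" "t powr p / max 1 K \<le> infdist y (frontier U)"
    "u\<^sub>1 x / u\<^sub>2 x \<le> exp (B * t powr \<delta>) * (u\<^sub>1 y / u\<^sub>2 y)"
proof -
  \<comment> \<open>Dividing by \<open>\<kappa>\<close> covers both kinds of points: corkscrew
    points, which lose a factor \<open>K\<close>, and the starting point, which loses none.\<close>
  define \<kappa> where "\<kappa> = max 1 K"
  define C where "C = \<bar>C\<^sub>1\<bar> * \<kappa> powr \<beta> / C\<^sub>4"
  define e where "e = C * t powr (\<zeta> - \<beta> * p\<^sup>2)"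
  define d where "d = 2 powr \<alpha> * t powr ((p - 1) * \<alpha>)"
  have \<kappa>: "\<kappa> \<ge> 1" "K \<le> \<kappa>" by (auto simp: \<kappa>_def)
  have t1: "t < 1" "t \<le> 1/4" using t T by auto
  have pp: "p \<le> p\<^sup>2" using params by (simp add: power2_eq_square)
  have tp: "t powr (p\<^sup>2) \<le> t powr p" using pp t t1 by (intro powr_mono') auto
  have tp': "t powr p = t * t powr (p - 1)" using t by (simp add: powr_diff)
  also have "\<dots> \<le> t * (1/8)" using small(2)[OF t] t by (intro mult_left_mono) auto
  finally have tpt: "t powr p < t / 2" using t by simp
  have "bounded U \<longrightarrow> t powr p < diameter U" using tpt T t by auto
  \<comment> \<open>A corkscrew point for the radius t^p. It satisfies the conditions on
    \<open>x\<close> at the next scale s = t^(1/p), because s^(p^2) = t^p.\<close>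
  then obtain y where y: "ball y (t powr p / K) \<subseteq> U \<inter> ball a (t powr p)"
    using nta a t unfolding one_sided_NTA_def by (metis powr_gt_zero less_irrefl)
  have "y \<in> ball y (t powr p / K)" using params t by simp
  then have "y \<in> U \<inter> ball a (t powr p)" using y by blast
  then have yU: "y \<in> U" "dist a y \<le> t powr p" by auto
  have "t powr p / \<kappa> \<le> t powr p / K" using params \<kappa> by (intro divide_left_mono) auto
  also have "\<dots> \<le> infdist y (frontier U)"
    using le_infdist_frontier[OF open_U] a y by blast
  finally have yd: "t powr p / \<kappa> \<le> infdist y (frontier U)" .
  have lower: "0 < u z" "C\<^sub>1 * t powr \<zeta> \<le> e * u z"
    if z: "z \<in> U" "t powr (p\<^sup>2) / \<kappa> \<le> infdist z (frontier U)" and uu: "u \<in> {u\<^sub>1, u\<^sub>2}" for z u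
  proof -
    have "C\<^sub>4 * (t powr (p\<^sup>2) / \<kappa>) powr \<beta> \<le> C\<^sub>4 * infdist z (frontier U) powr \<beta>"
      using params z \<kappa> by (intro mult_left_mono powr_mono2) auto
    also have "\<dots> \<le> u z" using u[OF uu] z by auto
    finally have uz: "C\<^sub>4 * (t powr (p\<^sup>2) / \<kappa>) powr \<beta> \<le> u z" .
    moreover have "0 < C\<^sub>4 * (t powr (p\<^sup>2) / \<kappa>) powr \<beta>" using params \<kappa> t by auto
    ultimately show "0 < u z" by linarith
    have "C\<^sub>1 * t powr \<zeta> \<le> \<bar>C\<^sub>1\<bar> * t powr \<zeta>" by (intro mult_right_mono) auto
    also have "\<dots> = \<bar>C\<^sub>1\<bar> * (t powr (\<zeta> - \<beta> * p\<^sup>2) * t powr (\<beta> * p\<^sup>2))"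
      by (simp add: powr_add[symmetric])
    \<comment> \<open>This identity dictates the choice of \<open>e\<close>: it is the approximation
      error divided by the lower bound for \<open>u\<close>.\<close>
    also have "\<dots> = e * (C\<^sub>4 * (t powr (p\<^sup>2) / \<kappa>) powr \<beta>)"
      using params \<kappa> t by (simp add: e_def C_def powr_divide powr_powr mult_ac)
    also have "\<dots> \<le> e * u z"
      using uz params by (intro mult_left_mono) (auto simp: e_def C_def)
    finally show "C\<^sub>1 * t powr \<zeta> \<le> e * u z" .
  qed
  have xd: "t powr (p\<^sup>2) / \<kappa> \<le> infdist x (frontier U)" using x by (simp add: \<kappa>_def)
  have yd': "t powr (p\<^sup>2) / \<kappa> \<le> infdist y (frontier U)"
    using yd tp \<kappa> by (meson divide_right_mono dual_order.trans zero_le_one)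
  have "dist x y \<le> 2 * t powr p" using dist_triangle3[of x y a] x yU tp by linarith
  then have "dist x y powr \<alpha> \<le> (2 * t powr p) powr \<alpha>" using params by (intro powr_mono2) auto
  also have "\<dots> = d * t powr \<alpha>"
    using t by (simp add: d_def powr_mult powr_powr powr_add[symmetric] algebra_simps)
  finally have dist: "dist x y powr \<alpha> \<le> d * t powr \<alpha>" .
  have "u\<^sub>1 x / u\<^sub>2 x \<le> exp (6 * e + \<bar>C\<^sub>3\<bar> * d) * (u\<^sub>1 y / u\<^sub>2 y)"
  proof (rule ratio_at_scale[OF a t(1) t1(2)])
    show "e \<le> 1/2" using small(1)[OF t] by (simp add: e_def C_def \<kappa>_def)
    show "0 \<le> e" using params by (simp add: e_def C_def)
  qed (use x yU tp tpt dist u lower xd yd' in auto)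
  also have "\<dots> \<le> exp (B * t powr \<delta>) * (u\<^sub>1 y / u\<^sub>2 y)"
  proof (intro mult_right_mono)
    have "6 * e \<le> 6 * (C * t powr \<delta>)" unfolding e_def
      using \<delta> t t1 params by (intro mult_left_mono powr_mono') (auto simp: C_def)
    moreover have "\<bar>C\<^sub>3\<bar> * d \<le> \<bar>C\<^sub>3\<bar> * (2 powr \<alpha> * t powr \<delta>)" unfolding d_def
      using \<delta> t t1 by (intro mult_left_mono powr_mono') auto
    ultimately show "exp (6 * e + \<bar>C\<^sub>3\<bar> * d) \<le> exp (B * t powr \<delta>)"
      by (simp add: B C_def \<kappa>_def algebra_simps)
  qed (use lower[OF yU(1) yd', of u\<^sub>1] lower[OF yU(1) yd', of u\<^sub>2] in auto)
  finally show ?thesis using that yU yd by (simp add: \<kappa>_def)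
qed

text \<open>The factor \<open>exp (2B(1 - t\<^bsup>\<delta>p\<^esup>))\<close> absorbs the losses \<open>exp (B t\<^sup>\<delta>)\<close> of all descent steps, because
  \<open>2 t\<^bsup>\<delta>p\<^esup> \<le> t\<^sup>\<delta>\<close> for small \<open>t\<close>.\<close>

lemma ratio_bound:
  assumes a: "a \<in> frontier U" "a \<in> ball 0 (1/2)" and M: "0 \<le> M"
    and base: "\<And>x. x \<in> U \<Longrightarrow> norm x \<le> 2 \<Longrightarrow> T powr (p\<^sup>2) / max 1 K \<le> infdist x (frontier U) \<Longrightarrow>
      u\<^sub>1 x / u\<^sub>2 x \<le> M"
    and t: "0 < t" "t < 1"
    and x: "x \<in> U" "dist a x \<le> t powr (p\<^sup>2)" "t powr (p\<^sup>2) / max 1 K \<le> infdist x (frontier U)"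
  shows "u\<^sub>1 x / u\<^sub>2 x \<le> M * exp (2 * B * (1 - t powr (\<delta> * p)))"
proof -
  have "B \<ge> 0" using params by (simp add: B)
  have "\<forall>x\<in>U. dist a x \<le> t powr (p\<^sup>2) \<longrightarrow> t powr (p\<^sup>2) / max 1 K \<le> infdist x (frontier U) \<longrightarrow>
    u\<^sub>1 x / u\<^sub>2 x \<le> M * exp (2 * B * (1 - t powr (\<delta> * p)))"
  proof (rule powr_scale_induct[where P = "\<lambda>t. \<forall>x\<in>U. dist a x \<le> t powr (p\<^sup>2) \<longrightarrow>
      t powr (p\<^sup>2) / max 1 K \<le> infdist x (frontier U) \<longrightarrow>
      u\<^sub>1 x / u\<^sub>2 x \<le> M * exp (2 * B * (1 - t powr (\<delta> * p)))", OF params(5) T(1) _ _ _ t])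
    show "T < 1" using T by simp
  next
    fix t assume t: "T \<le> t" "t < 1"
    show "\<forall>x\<in>U. dist a x \<le> t powr (p\<^sup>2) \<longrightarrow> t powr (p\<^sup>2) / max 1 K \<le> infdist x (frontier U) \<longrightarrow>
      u\<^sub>1 x / u\<^sub>2 x \<le> M * exp (2 * B * (1 - t powr (\<delta> * p)))"
    proof (intro ballI impI)
      fix x assume x: "x \<in> U" "dist a x \<le> t powr (p\<^sup>2)"
        "t powr (p\<^sup>2) / max 1 K \<le> infdist x (frontier U)"
      have "t powr (p\<^sup>2) \<le> 1" using t T params by (intro powr_le1) auto
      then have "norm x \<le> 2"
        using x a norm_triangle_ineq[of "x - a" a] by (auto simp: dist_norm norm_minus_commute)
      moreover have "T powr (p\<^sup>2) / max 1 K \<le> t powr (p\<^sup>2) / max 1 K"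
        using t T by (intro divide_right_mono powr_mono2) auto
      ultimately have "u\<^sub>1 x / u\<^sub>2 x \<le> M * 1" using base[OF x(1)] x(3) by simp
      also have "t powr (\<delta> * p) \<le> 1" using t T params \<delta> by (intro powr_le1) auto
      then have "M * 1 \<le> M * exp (2 * B * (1 - t powr (\<delta> * p)))"
        using M \<open>B \<ge> 0\<close> by (intro mult_left_mono) auto
      finally show "u\<^sub>1 x / u\<^sub>2 x \<le> M * exp (2 * B * (1 - t powr (\<delta> * p)))" .
    qed
  next
    fix t assume t: "0 < t" "t < T"
      and IH: "\<forall>x\<in>U. dist a x \<le> (t powr (1/p)) powr (p\<^sup>2) \<longrightarrow>
        (t powr (1/p)) powr (p\<^sup>2) / max 1 K \<le> infdist x (frontier U) \<longrightarrow>
        u\<^sub>1 x / u\<^sub>2 x \<le> M * exp (2 * B * (1 - (t powr (1/p)) powr (\<delta> * p)))"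
    have eqs: "(t powr (1/p)) powr (p\<^sup>2) = t powr p" "(t powr (1/p)) powr (\<delta> * p) = t powr \<delta>"
      using params by (auto simp: powr_powr power2_eq_square)
    show "\<forall>x\<in>U. dist a x \<le> t powr (p\<^sup>2) \<longrightarrow> t powr (p\<^sup>2) / max 1 K \<le> infdist x (frontier U) \<longrightarrow>
      u\<^sub>1 x / u\<^sub>2 x \<le> M * exp (2 * B * (1 - t powr (\<delta> * p)))"
    proof (intro ballI impI)
      fix x assume x: "x \<in> U" "dist a x \<le> t powr (p\<^sup>2)"
        "t powr (p\<^sup>2) / max 1 K \<le> infdist x (frontier U)"
      obtain y where y: "y \<in> U" "dist a y \<le> t powr p" "t powr p / max 1 K \<le> infdist y (frontier U)"
        "u\<^sub>1 x / u\<^sub>2 x \<le> exp (B * t powr \<delta>) * (u\<^sub>1 y / u\<^sub>2 y)"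
        using ratio_descent[OF a t x] by blast
      note y(4)
      also have "u\<^sub>1 y / u\<^sub>2 y \<le> M * exp (2 * B * (1 - t powr \<delta>))" using IH y by (simp add: eqs)
      also have "exp (B * t powr \<delta>) * (M * exp (2 * B * (1 - t powr \<delta>)))
          = M * exp (2 * B - B * t powr \<delta>)"
        by (simp add: exp_add[symmetric] algebra_simps)
      also have "\<dots> \<le> M * exp (2 * B * (1 - t powr (\<delta> * p)))"
      proof -
        have "t powr (\<delta> * p) = t powr \<delta> * t powr (\<delta> * (p - 1))"
          by (simp add: powr_add[symmetric] algebra_simps)
        also have "\<dots> \<le> t powr \<delta> * (1/2)" using small(3)[OF t] by (intro mult_left_mono) auto
        finally have "2 * B * t powr (\<delta> * p) \<le> 2 * B * (t powr \<delta> * (1/2))"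
          using \<open>B \<ge> 0\<close> by (intro mult_left_mono) auto
        then show ?thesis using M by (intro mult_left_mono) (auto simp: algebra_simps)
      qed
      finally show "u\<^sub>1 x / u\<^sub>2 x \<le> M * exp (2 * B * (1 - t powr (\<delta> * p)))" by simp
    qed
  qed
  then show ?thesis using x by blast
qed

end

section \<open>Choice of constants and conclusion\<close>

text \<open>Taking p^2 to be the midpoint of 1 and \<zeta> / \<beta> makes \<beta> p^2 the midpoint
  of \<beta> and \<zeta>; \<open>\<delta>\<close> is then the smaller of the two upper
  bounds.\<close>

lemma exponents_exist:
  fixes \<alpha> \<beta> \<zeta> :: real
  assumes "0 < \<alpha>" "0 < \<beta>" "\<beta> < \<zeta>"
  obtains p \<delta> where "1 < p" "0 < \<delta>" "\<delta> \<le> \<zeta> - \<beta> * p\<^sup>2" "\<delta> \<le> (p - 1) * \<alpha>"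
proof -
  define p where "p = sqrt ((1 + \<zeta> / \<beta>) / 2)"
  have "1 < \<zeta> / \<beta>" using assms by simp
  then have "1 < p" by (simp add: p_def)
  have "p\<^sup>2 = (1 + \<zeta> / \<beta>) / 2" using \<open>1 < \<zeta> / \<beta>\<close> by (simp add: p_def)
  then have "\<zeta> - \<beta> * p\<^sup>2 > 0" using assms by (simp add: field_simps)
  then show ?thesis
    using that[OF \<open>1 < p\<close>, of "min (\<zeta> - \<beta> * p\<^sup>2) ((p - 1) * \<alpha>)"] \<open>1 < p\<close> assms by simp
qed

theorem theorem2p2:
  fixes K :: real
  assumes "CARD('n::finite) \<ge> 2" and "K > 0"
  shows "\<exists>c. 0 < c \<and> c < 1 \<and>
    (\<forall>C\<^sub>1 C\<^sub>2 C\<^sub>3 C\<^sub>4 \<zeta> \<beta> \<alpha>. \<zeta> > 1 \<and> \<alpha> > 0 \<and> 0 < \<beta> \<and> \<beta> < \<zeta> \<and> C\<^sub>4 > 0 \<longrightarrow>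
      (\<exists>C :: real. \<forall>(Q :: (real ^ 'n) set set) H U V W u\<^sub>1 u\<^sub>2 x\<^sub>0.
        solution_family Q H \<longrightarrow> U \<in> Q \<longrightarrow> V \<subseteq> nonneg_solutions H U \<longrightarrow>
        localization Q U W \<longrightarrow> homogeneity Q H \<longrightarrow> solvability Q H \<longrightarrow>
        extension Q H \<longrightarrow> comparison Q H \<longrightarrow>
        approximation_property H U W V C\<^sub>1 \<zeta> \<longrightarrow> harnack U V C\<^sub>2 \<longrightarrow>
        boundary_harnack H U W C\<^sub>3 \<alpha> \<longrightarrow>
        one_sided_NTA K U \<longrightarrow> 0 \<in> frontier U \<longrightarrow>
        (\<forall>u\<in>{u\<^sub>1, u\<^sub>2}. u \<in> V \<and>
           (\<forall>x\<in>U \<inter> ball 0 1. u x > 0) \<and>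
           (\<forall>x\<in>frontier U \<inter> ball 0 1. u x = 0) \<and>
           (\<forall>x\<in>U. u x \<ge> C\<^sub>4 * infdist x (frontier U \<inter> ball 0 1) powr \<beta>)) \<longrightarrow>
        x\<^sub>0 \<in> U \<inter> ball 0 c \<longrightarrow> infdist x\<^sub>0 (frontier U) \<ge> c\<^sup>2 \<longrightarrow> u\<^sub>1 x\<^sub>0 = 1 \<longrightarrow>
        (\<forall>x\<in>ball 0 c \<inter> U. u\<^sub>1 x / u\<^sub>2 x \<le> C)))"
proof (rule exI[of _ "1/8"], intro conjI allI impI)
  \<comment> \<open>With \<open>c = 1/8\<close>, the boundary point nearest to a point of
    \<open>ball 0 c\<close> has norm below 1/4, inside the range of the approximation
    property.\<close>
  fix C\<^sub>1 C\<^sub>2 C\<^sub>3 C\<^sub>4 \<zeta> \<beta> \<alpha> :: real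
  assume par: "\<zeta> > 1 \<and> \<alpha> > 0 \<and> 0 < \<beta> \<and> \<beta> < \<zeta> \<and> C\<^sub>4 > 0"
  obtain p \<delta> where p: "1 < p" and \<delta>: "0 < \<delta>" "\<delta> \<le> \<zeta> - \<beta> * p\<^sup>2" "\<delta> \<le> (p - 1) * \<alpha>"
    using exponents_exist[of \<alpha> \<beta> \<zeta>] par by blast
  define C' where "C' = \<bar>C\<^sub>1\<bar> * max 1 K powr \<beta> / C\<^sub>4"
  define B where "B = 6 * C' + \<bar>C\<^sub>3\<bar> * 2 powr \<alpha>"
  have "0 < \<zeta> - \<beta> * p\<^sup>2" "0 < p - 1" "0 < \<delta> * (p - 1)" using p \<delta> by auto
  then obtain b1 b2 b3 where b: "b1 > 0" "b2 > 0" "b3 > 0"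
    "\<forall>t. 0 < t \<and> t < b1 \<longrightarrow> C' * t powr (\<zeta> - \<beta> * p\<^sup>2) \<le> 1/2"
    "\<forall>t. 0 < t \<and> t < b2 \<longrightarrow> 4 * t powr (p - 1) \<le> 1/2"
    "\<forall>t. 0 < t \<and> t < b3 \<longrightarrow> t powr (\<delta> * (p - 1)) \<le> 1/2"
    using powr_times_const_small[of "\<zeta> - \<beta> * p\<^sup>2" C'] powr_times_const_small[of "p - 1" 4]
      powr_times_const_small[of "\<delta> * (p - 1)" 1] by (metis mult_1)
  \<comment> \<open>The entry 1/64 is c^2: since \<open>x\<^sub>0\<close> and 0 lie in
    \<open>closure U\<close> at distance at least c^2, it keeps \<open>T\<close> below the diameter
    of a bounded \<open>U\<close>.\<close>
  define T where "T = Min {1/64, b1, b2, b3}"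
  have T: "0 < T" "T \<le> 1/64" "T \<le> b1" "T \<le> b2" "T \<le> b3" using b by (auto simp: T_def)
  \<comment> \<open>A common lower bound for the distances to the boundary from
    \<open>x\<^sub>0\<close> and from the points at the fixed scale.\<close>
  define m where "m = min (1/64) (T powr (p\<^sup>2) / max 1 K)"
  have m: "0 < m" "m \<le> 1/64" "m \<le> T powr (p\<^sup>2) / max 1 K"
    using T by (auto simp: m_def max_def simp del: le_divide_eq_numeral1)
  obtain M where "M > 0" and M: "\<And>(U :: (real ^ 'n) set) V H u x y.
    harnack U V C\<^sub>2 \<Longrightarrow> V \<subseteq> nonneg_solutions H U \<Longrightarrow> u \<in> V \<Longrightarrow> one_sided_NTA K U \<Longrightarrow>
    frontier U \<noteq> {} \<Longrightarrow> x \<in> U \<Longrightarrow> y \<in> U \<Longrightarrow> m \<le> infdist x (frontier U) \<Longrightarrow>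
    m \<le> infdist y (frontier U) \<Longrightarrow> dist x y \<le> 4 \<Longrightarrow> u y + 1 \<le> M * (u x + 1)"
    using harnack_NTA[OF \<open>K > 0\<close> m(1), of C\<^sub>2 4] by blast
  \<comment> \<open>The numerator is the Harnack chain bound
    \<open>M * (u\<^sub>1 x\<^sub>0 + 1)\<close> with \<open>u\<^sub>1 x\<^sub>0 = 1\<close>; the
    denominator is the lower bound for \<open>u\<^sub>2\<close>.\<close>
  define M\<^sub>0 where "M\<^sub>0 = 2 * M / (C\<^sub>4 * m powr \<beta>)"
  have "M\<^sub>0 > 0" using \<open>M > 0\<close> par m by (simp add: M\<^sub>0_def)
  show "\<exists>C :: real. \<forall>(Q :: (real ^ 'n) set set) H U V W u\<^sub>1 u\<^sub>2 x\<^sub>0.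
        solution_family Q H \<longrightarrow> U \<in> Q \<longrightarrow> V \<subseteq> nonneg_solutions H U \<longrightarrow>
        localization Q U W \<longrightarrow> homogeneity Q H \<longrightarrow> solvability Q H \<longrightarrow>
        extension Q H \<longrightarrow> comparison Q H \<longrightarrow>
        approximation_property H U W V C\<^sub>1 \<zeta> \<longrightarrow> harnack U V C\<^sub>2 \<longrightarrow>
        boundary_harnack H U W C\<^sub>3 \<alpha> \<longrightarrow>
        one_sided_NTA K U \<longrightarrow> 0 \<in> frontier U \<longrightarrow>
        (\<forall>u\<in>{u\<^sub>1, u\<^sub>2}. u \<in> V \<and>
           (\<forall>x\<in>U \<inter> ball 0 1. u x > 0) \<and>
           (\<forall>x\<in>frontier U \<inter> ball 0 1. u x = 0) \<and>
           (\<forall>x\<in>U. u x \<ge> C\<^sub>4 * infdist x (frontier U \<inter> ball 0 1) powr \<beta>)) \<longrightarrow>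
        x\<^sub>0 \<in> U \<inter> ball 0 (1/8) \<longrightarrow> infdist x\<^sub>0 (frontier U) \<ge> (1/8)\<^sup>2 \<longrightarrow> u\<^sub>1 x\<^sub>0 = 1 \<longrightarrow>
        (\<forall>x\<in>ball 0 (1/8) \<inter> U. u\<^sub>1 x / u\<^sub>2 x \<le> C)"
  proof (intro exI[of _ "M\<^sub>0 * exp (2 * B)"] allI impI ballI)
    fix Q :: "(real ^ 'n) set set" and H U V W u\<^sub>1 u\<^sub>2 x\<^sub>0 x
    assume setting: "solution_family Q H" "U \<in> Q" "V \<subseteq> nonneg_solutions H U" "localization Q U W"
        "homogeneity Q H" "solvability Q H" "extension Q H" "comparison Q H"
        "approximation_property H U W V C\<^sub>1 \<zeta>" "boundary_harnack H U W C\<^sub>3 \<alpha>"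
      and har: "harnack U V C\<^sub>2" and nta: "one_sided_NTA K U" and 0: "0 \<in> frontier U"
      and u: "\<forall>u\<in>{u\<^sub>1, u\<^sub>2}. u \<in> V \<and>
           (\<forall>x\<in>U \<inter> ball 0 1. u x > 0) \<and>
           (\<forall>x\<in>frontier U \<inter> ball 0 1. u x = 0) \<and>
           (\<forall>x\<in>U. u x \<ge> C\<^sub>4 * infdist x (frontier U \<inter> ball 0 1) powr \<beta>)"
      and x0: "x\<^sub>0 \<in> U \<inter> ball 0 (1/8)" "infdist x\<^sub>0 (frontier U) \<ge> (1/8)\<^sup>2" "u\<^sub>1 x\<^sub>0 = 1"
      and x: "x \<in> ball 0 (1/8) \<inter> U"
    have x0d: "1/64 \<le> infdist x\<^sub>0 (frontier U)" using x0(2) by (simp add: power2_eq_square)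
    have lower: "C\<^sub>4 * infdist z (frontier U) powr \<beta> \<le> u z" if "z \<in> U" "u \<in> {u\<^sub>1, u\<^sub>2}" for z u
    proof -
      \<comment> \<open>The smaller set contains 0; this matters because \<open>infdist\<close> to
        the empty set is 0.\<close>
      have "infdist z (frontier U) \<le> infdist z (frontier U \<inter> ball 0 1)"
        using 0 by (intro infdist_mono) auto
      then have "C\<^sub>4 * infdist z (frontier U) powr \<beta> \<le> C\<^sub>4 * infdist z (frontier U \<inter> ball 0 1) powr \<beta>"
        using par by (intro mult_left_mono powr_mono2) (auto simp: infdist_nonneg)
      also have "\<dots> \<le> u z" using u that by blast
      finally show ?thesis .
    qed
    interpret boundary_harnack_pair Q H U V W C\<^sub>1 C\<^sub>3 \<zeta> \<alpha> u\<^sub>1 u\<^sub>2 K C\<^sub>4 \<beta> p \<delta> B T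
    proof
      show "T \<le> diameter U" if "bounded U"
      proof -
        have "x\<^sub>0 \<in> closure U" "0 \<in> closure U"
          using x0 0 closure_subset by (auto simp: frontier_def)
        then have "dist x\<^sub>0 0 \<le> diameter (closure U)"
          using that by (intro diameter_bounded_bound) auto
        moreover have "1/64 \<le> dist x\<^sub>0 0" using x0d infdist_le[OF 0, of x\<^sub>0] by linarith
        ultimately show ?thesis using T that by (simp add: diameter_closure)
      qed
    qed (use setting nta par p \<delta> T b u lower assms in \<open>auto simp: B_def C'_def\<close>)
    have base: "u\<^sub>1 z / u\<^sub>2 z \<le> M\<^sub>0"
      if z: "z \<in> U" "norm z \<le> 2" "T powr (p\<^sup>2) / max 1 K \<le> infdist z (frontier U)" for z
      unfolding M\<^sub>0_def
    proof (rule frac_le)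
      have "dist x\<^sub>0 z \<le> 4"
        using x0 z norm_triangle_ineq4[of x\<^sub>0 z] by (auto simp: dist_norm)
      then have "u\<^sub>1 z + 1 \<le> M * (u\<^sub>1 x\<^sub>0 + 1)"
        using M[OF har setting(3) _ nta, of u\<^sub>1 x\<^sub>0 z] u x0 0 z x0d m by fastforce
      then show "u\<^sub>1 z \<le> 2 * M" using x0 by simp
      have "C\<^sub>4 * m powr \<beta> \<le> C\<^sub>4 * infdist z (frontier U) powr \<beta>"
        using par m z by (intro mult_left_mono powr_mono2) auto
      then show "C\<^sub>4 * m powr \<beta> \<le> u\<^sub>2 z" using lower[OF z(1), of u\<^sub>2] by simp
    qed (use \<open>M > 0\<close> par m in auto)
    obtain a where a: "a \<in> frontier U" "infdist x (frontier U) = dist x a"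
      using infdist_attains_inf[of "frontier U" x] 0 by auto
    \<comment> \<open>The scale is chosen so that t^(p^2) is exactly the distance from
      \<open>x\<close> to the boundary, attained at \<open>a\<close>; both conditions of
      \<open>ratio_bound\<close> on \<open>x\<close> then hold.\<close>
    define t where "t = dist x a powr (1 / p\<^sup>2)"
    have "x \<notin> frontier U" using x open_U by (simp add: frontier_def interior_open)
    then have "dist x a > 0" using a by auto
    have "dist x a < 1/8" using infdist_le[OF 0, of x] a x by (simp add: dist_commute)
    then have "a \<in> ball 0 (1/2)"
      using x norm_triangle_ineq[of "a - x" x] by (auto simp: dist_norm norm_minus_commute)
    have "t powr (p\<^sup>2) = dist x a" "0 < t" using p \<open>dist x a > 0\<close> by (auto simp: t_def powr_powr)
    have "t < 1 powr (1 / p\<^sup>2)" unfolding t_def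
      using p \<open>dist x a < 1/8\<close> by (intro powr_less_mono2) auto
    have "dist x a / max 1 K \<le> dist x a / 1" by (intro divide_left_mono) auto
    then have "u\<^sub>1 x / u\<^sub>2 x \<le> M\<^sub>0 * exp (2 * B * (1 - t powr (\<delta> * p)))"
      using ratio_bound[OF a(1) \<open>a \<in> ball 0 (1/2)\<close> _ base \<open>0 < t\<close>, of x] \<open>M\<^sub>0 > 0\<close> x a
        \<open>t powr (p\<^sup>2) = dist x a\<close> \<open>t < 1 powr (1 / p\<^sup>2)\<close>
      by (auto simp: dist_commute)
    also have "\<dots> \<le> M\<^sub>0 * exp (2 * B)"
    proof (intro mult_left_mono)
      have "0 \<le> B" using par by (simp add: B_def C'_def)
      then show "exp (2 * B * (1 - t powr (\<delta> * p))) \<le> exp (2 * B)"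
        by (simp add: algebra_simps)
    qed (use \<open>M\<^sub>0 > 0\<close> in simp)
    finally show "u\<^sub>1 x / u\<^sub>2 x \<le> M\<^sub>0 * exp (2 * B)" .
  qed
qed simp_all

end
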